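(* Let $q$ be a prime power and $1\le d\le q$. Let $P\mathcal{U}_1\subset\mathbb{P}^2$ be a Hermitian curve of rank $2$ over $\mathbb{F}_{q^2}$ with vertex $P$. If $V(F)$ is an $\mathbb{F}_{q^2}$-curve of degree $d$ in $\mathbb{P}^2$, then $$|(P\mathcal{U}_1\cap V(F))(\mathbb{F}_{q^2})|\le dq^2+1.$$ Moreover, the bound is attained if and only if $V(F)$ is a union of $d$ (distinct) lines, each contained in the curve $P\mathcal{U}_1$.
   Context: $\mathbb{P}^2$ is the projective plane over $\overline{\mathbb{F}}_q$, and $X(\mathbb{F}_{q^2})$ is the set of $\mathbb{F}_{q^2}$-rational points of $X$. An $\mathbb{F}_{q^2}$-curve of degree $d$ in $\mathbb{P}^2$ is the zero set $V(F)$ of a nonzero homogeneous $F\in\mathbb{F}_{q^2}[x_0,x_1,x_2]$ of degree $d$ (not necessarily irreducible or reduced). A Hermitian curve of rank $2$ in $\mathbb{P}^2$ is the zero set of $\sum_{i,j}h_{ij}x_ix_j^q$ for a $3\times 3$ matrix $H=(h_{ij})$ over $\mathbb{F}_{q^2}$ of rank $2$ with $h_{ij}=h_{ji}^q$. Up to an $\mathbb{F}_{q^2}$-linear change of coordinates it is $V(x_0^{q+1}+x_1^{q+1})$, a union of $q+1$ lines defined over $\mathbb{F}_{q^2}$ through a common $\mathbb{F}_{q^2}$-point $P$ (the vertex; $P=[0:0:1]$ in these coordinates); it is denoted $P\mathcal{U}_1$. *)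

theory Defs
  imports
    "HOL-Analysis.Analysis"
    "HOL-Library.Poly_Mapping"
    "HOL-Algebra.Algebraic_Closure_Type"
    "HOL-Number_Theory.Prime_Powers"
begin

unbundle no fps_syntax

text \<open>
  Throughout, \<open>'k\<close> is the ground field \<open>\<F>\<^bsub>q\<^sup>2\<^esub>\<close> (a finite field with
  \<open>q\<^sup>2\<close> elements) and \<open>'k alg_closure\<close> its algebraic closure, which is also an
  algebraic closure of \<open>\<F>\<^sub>q\<close>; \<open>to_ac\<close> is the embedding.
\<close>

text \<open>A point of the projective plane is a one-dimensional subspace of \<open>'a ^ 3\<close>.\<close>

definition proj_point :: "'a::field ^ 3 \<Rightarrow> ('a ^ 3) set" where
  "proj_point v = vec.span {v}"

definition rational_points ::
    "('k::field alg_closure ^ 3) set set \<Rightarrow> ('k alg_closure ^ 3) set set" where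
  "rational_points S = S \<inter> {proj_point (\<chi> i. to_ac (w $ i)) | w :: 'k ^ 3. w \<noteq> 0}"

text \<open>
  Polynomials in three variables, indexed by the type \<open>3\<close>: finitely supported maps
  from monomials (exponent vectors) to coefficients.
\<close>

type_synonym 'k poly3 = "(3 \<Rightarrow>\<^sub>0 nat) \<Rightarrow>\<^sub>0 'k"

definition homogeneous :: "nat \<Rightarrow> 'k::zero poly3 \<Rightarrow> bool" where
  "homogeneous d F \<longleftrightarrow>
     (\<forall>m \<in> Poly_Mapping.keys F. (\<Sum>i\<in>UNIV. Poly_Mapping.lookup m i) = d)"

definition eval_ac :: "'k::field poly3 \<Rightarrow> 'k alg_closure ^ 3 \<Rightarrow> 'k alg_closure" where
  "eval_ac F v = (\<Sum>m\<in>Poly_Mapping.keys F.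
     to_ac (Poly_Mapping.lookup F m) * (\<Prod>i\<in>UNIV. v $ i ^ Poly_Mapping.lookup m i))"

definition zero_set :: "'k::field poly3 \<Rightarrow> ('k alg_closure ^ 3) set set" where
  "zero_set F = {proj_point v | v. v \<noteq> 0 \<and> eval_ac F v = 0}"

definition proj_lines :: "('a::field ^ 3) set set set" where
  "proj_lines = {{proj_point v | v. v \<noteq> 0 \<and> (\<Sum>i\<in>UNIV. a $ i * v $ i) = 0} | a. a \<noteq> 0}"

definition hermitian_matrix :: "nat \<Rightarrow> 'k::field ^ 3 ^ 3 \<Rightarrow> bool" where
  "hermitian_matrix q H \<longleftrightarrow> (\<forall>i j. H $ i $ j = (H $ j $ i) ^ q)"

definition hermitian_curve ::
    "nat \<Rightarrow> 'k::field ^ 3 ^ 3 \<Rightarrow> ('k alg_closure ^ 3) set set" where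
  "hermitian_curve q H = {proj_point v | v.
     v \<noteq> 0 \<and> (\<Sum>i\<in>UNIV. \<Sum>j\<in>UNIV. to_ac (H $ i $ j) * v $ i * (v $ j) ^ q) = 0}"

end

theory Submission
  imports Defs "HOL-Number_Theory.Residues"
begin

text \<open>
  In a basis \<open>P, A, B\<close> of \<open>\<F>\<^bsub>q\<^sup>2\<^esub>\<close>-vectors, with \<open>P\<close> spanning the kernel of the form and \<open>A\<close>, \<open>B\<close>
  orthogonal, the curve is \<open>\<alpha> x\<^sup>q\<^sup>+\<^sup>1 + \<beta> y\<^sup>q\<^sup>+\<^sup>1 = 0\<close>; surjectivity of the norm splits it into the \<open>q + 1\<close>
  rational lines \<open>y = c x\<close> with \<open>c\<^sup>q\<^sup>+\<^sup>1 = - \<alpha> / \<beta>\<close>. Write \<open>F (s P + A + c B) = \<Sum>\<^sub>j g\<^sub>j(c) s\<^sup>j\<close> with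
  \<open>deg g\<^sub>j \<le> d - j\<close>. If \<open>F\<close> vanishes on \<open>t\<close> of the lines, every \<open>g\<^sub>j\<close> has \<open>t\<close> roots, so the degree in \<open>s\<close>
  is at most \<open>d - t\<close>; hence \<open>t \<le> d\<close> and each remaining line carries at most \<open>d - t\<close> zeros besides
  the vertex. The number of rational points is thus at most
  \<open>1 + t q\<^sup>2 + (q + 1) (d - t)\<close>, which is less than \<open>d q\<^sup>2 + 1\<close> unless \<open>t = d\<close>. For \<open>t = d\<close> only \<open>g\<^sub>0\<close> survives,
  and it has degree \<open>d\<close> and exactly the \<open>d\<close> roots given by the lines.
\<close>

no_notation fps_nth (infixl "$" 75)
hide_const (open) up_ring.coeff up_ring.monom Polynomials.degree Polynomials.lead_coeff
  Divisibility.prime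

section \<open>Bivariate polynomials of bounded total degree\<close>

text \<open>Euclid's argument: over a finite field, one plus the product of all \<open>X - a\<close>
  has positive degree but takes the value 1 everywhere.\<close>

lemma infinite_UNIV_alg_closed: "infinite (UNIV :: 'a::alg_closed_field set)"
proof
  assume fin: "finite (UNIV :: 'a set)"
  define p :: "'a poly" where "p = (\<Prod>a\<in>UNIV. [:- a, 1:]) + 1"
  have deg: "degree (\<Prod>a\<in>(UNIV :: 'a set). [:- a, 1:]) = card (UNIV :: 'a set)"
    by (subst degree_prod_eq_sum_degree) auto
  have "card (UNIV :: 'a set) > 0"
    using fin by (simp add: card_gt_0_iff)
  hence "degree p = card (UNIV :: 'a set)"
    unfolding p_def by (subst degree_add_eq_left) (auto simp: deg)
  with \<open>card (UNIV :: 'a set) > 0\<close> obtain x where "poly p x = 0"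
    using alg_closed_imp_poly_has_root[of p] by auto
  moreover have "poly (\<Prod>a\<in>UNIV. [:- a, 1:]) x = 0"
    using fin by (auto simp: poly_prod)
  ultimately show False
    by (simp add: p_def)
qed

text \<open>Serves as a density argument: vanishing checked away from finitely many parameter values
  extends to the excluded ones.\<close>

lemma poly_eq_0_if_cofinite_roots:
  fixes p :: "'a::alg_closed_field poly"
  assumes "finite A" "\<And>x. x \<notin> A \<Longrightarrow> poly p x = 0"
  shows "p = 0"
proof (rule ccontr)
  assume "p \<noteq> 0"
  hence "finite {x. poly p x = 0}"
    by (rule poly_roots_finite)
  moreover have "UNIV = {x. poly p x = 0} \<union> A"
    using assms(2) by auto
  ultimately show False
    using infinite_UNIV_alg_closed[where ?'a = 'a] assms(1) by (metis finite_UnI)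
qed

text \<open>The outer variable is \<open>s\<close>, the inner one \<open>c\<close>. The guard is
  there because the zero polynomial has degree 0, so the bare inequality would fail at vanishing
  coefficients with \<open>j > n\<close>.\<close>

definition total_degree_le :: "nat \<Rightarrow> 'a::comm_ring_1 poly poly \<Rightarrow> bool" where
  "total_degree_le n p \<longleftrightarrow> (\<forall>j. coeff p j \<noteq> 0 \<longrightarrow> degree (coeff p j) + j \<le> n)"

lemma total_degree_le_0 [simp]: "total_degree_le n 0"
  by (simp add: total_degree_le_def)

lemma total_degree_le_const: "total_degree_le 0 [:[:a:]:]"
  by (auto simp: total_degree_le_def coeff_pCons split: nat.splits)

lemma total_degree_le_linear: "total_degree_le 1 [:[:a, b:], [:c:]:]"
  by (auto simp: total_degree_le_def coeff_pCons split: nat.splits)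

lemma total_degree_le_add:
  assumes "total_degree_le n p" "total_degree_le n r"
  shows "total_degree_le n (p + r)"
  unfolding total_degree_le_def
proof (intro allI impI)
  fix j assume nz: "coeff (p + r) j \<noteq> 0"
  \<comment> \<open>Subtraction truncates, so the bound by \<open>n - j\<close> yields the additive
    form only together with \<open>j \<le> n\<close>, which is shown separately.\<close>
  have deg: "degree (coeff p' j) \<le> n - j" if "total_degree_le n p'" for p' :: "'a poly poly"
    using that by (cases "coeff p' j = 0") (auto simp: total_degree_le_def dest!: spec[of _ j])
  have "degree (coeff (p + r) j) \<le> n - j"
    using deg[OF assms(1)] deg[OF assms(2)] by (simp add: degree_add_le)
  moreover have "coeff p j \<noteq> 0 \<or> coeff r j \<noteq> 0"
    using nz by auto
  hence "j \<le> n"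
    using assms unfolding total_degree_le_def by fastforce
  ultimately show "degree (coeff (p + r) j) + j \<le> n"
    by simp
qed

lemma total_degree_le_sum:
  assumes "\<And>x. x \<in> S \<Longrightarrow> total_degree_le n (f x)"
  shows "total_degree_le n (\<Sum>x\<in>S. f x)"
  using assms by (induction S rule: infinite_finite_induct) (auto intro: total_degree_le_add)

lemma total_degree_le_mult:
  assumes "total_degree_le n p" "total_degree_le m r"
  shows "total_degree_le (n + m) (p * r)"
  unfolding total_degree_le_def
proof (intro allI impI)
  fix j assume nz: "coeff (p * r) j \<noteq> 0"
  have summand: "degree (coeff p i * coeff r (j - i)) \<le> n + m - j \<and> j \<le> n + m"
    if "i \<le> j" "coeff p i * coeff r (j - i) \<noteq> 0" for i
  proof -
    have "coeff p i \<noteq> 0" "coeff r (j - i) \<noteq> 0"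
      using that by auto
    hence "degree (coeff p i) + i \<le> n" "degree (coeff r (j - i)) + (j - i) \<le> m"
      using assms by (auto simp: total_degree_le_def)
    thus ?thesis
      using degree_mult_le[of "coeff p i" "coeff r (j - i)"] \<open>i \<le> j\<close> by linarith
  qed
  have "degree (coeff (p * r) j) \<le> n + m - j"
    unfolding coeff_mult
  proof (rule degree_sum_le)
    fix i assume "i \<in> {..j}"
    thus "degree (coeff p i * coeff r (j - i)) \<le> n + m - j"
      using summand[of i] by (cases "coeff p i * coeff r (j - i) = 0") auto
  qed simp
  moreover obtain i where "i \<le> j" "coeff p i * coeff r (j - i) \<noteq> 0"
    using nz unfolding coeff_mult by (meson atMost_iff sum.not_neutral_contains_not_neutral)
  hence "j \<le> n + m"
    using summand by blast
  ultimately show "degree (coeff (p * r) j) + j \<le> n + m"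
    by simp
qed

lemma total_degree_le_power:
  assumes "total_degree_le n p"
  shows "total_degree_le (k * n) (p ^ k)"
proof (induction k)
  case 0
  thus ?case using total_degree_le_const[of 1] by (simp add: one_pCons)
qed (auto intro: total_degree_le_mult assms)

lemma total_degree_le_prod:
  fixes f :: "'b \<Rightarrow> 'a::comm_ring_1 poly poly"
  assumes "\<And>x. x \<in> S \<Longrightarrow> total_degree_le (n x) (f x)"
  shows "total_degree_le (\<Sum>x\<in>S. n x) (\<Prod>x\<in>S. f x)"
  using assms
proof (induction S rule: infinite_finite_induct)
  case (insert x S)
  thus ?case by (auto intro: total_degree_le_mult)
qed (use total_degree_le_const[of "1 :: 'a"] in \<open>auto simp: one_pCons\<close>)

text \<open>Evaluation fixes \<open>s\<close> first; the right-hand side fixes \<open>c\<close>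
  first and leaves a polynomial in \<open>s\<close>, the restriction to one line.\<close>

lemma poly_poly_const_eq_poly_map_poly:
  "poly (poly G [:s:]) c = poly (map_poly (\<lambda>g. poly g c) G) s"
  by (induction G) (simp_all add: map_poly_pCons)

text \<open>For \<open>c\<close> in \<open>T\<close> the polynomial in \<open>s\<close> vanishes
  identically, so \<open>c\<close> is a root of every coefficient. It suffices to count roots of the
  leading one, which is nonzero of degree at most \<open>n - degree G\<close>.\<close>

lemma total_degree_le_roots:
  fixes G :: "'a::alg_closed_field poly poly"
  assumes G: "total_degree_le n G" "G \<noteq> 0"
    and T: "\<And>c s. c \<in> T \<Longrightarrow> poly (poly G [:s:]) c = 0"
  shows "card T + degree G \<le> n"
proof -
  have root: "poly (coeff G j) c = 0" if "c \<in> T" for c j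
  proof -
    have "map_poly (\<lambda>g. poly g c) G = 0"
      by (rule poly_eq_0_if_cofinite_roots[of "{}"])
        (use T that in \<open>auto simp flip: poly_poly_const_eq_poly_map_poly\<close>)
    hence "coeff (map_poly (\<lambda>g. poly g c) G) j = 0"
      by simp
    thus ?thesis
      by (simp add: coeff_map_poly)
  qed
  have lc: "lead_coeff G \<noteq> 0"
    using G by simp
  have sub: "T \<subseteq> {c. poly (lead_coeff G) c = 0}"
    using root by auto
  have "card T \<le> degree (lead_coeff G)"
    using card_mono[OF poly_roots_finite[OF lc] sub] card_poly_roots_bound[OF lc] by linarith
  moreover have "degree (lead_coeff G) + degree G \<le> n"
    using G lc unfolding total_degree_le_def by blast
  ultimately show "card T + degree G \<le> n"
    by linarith
qed

section \<open>Ternary forms\<close>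

lemma eval_ac_scale:
  assumes "homogeneous d F"
  shows "eval_ac F (r *s v) = r ^ d * eval_ac F v"
  unfolding eval_ac_def sum_distrib_left
proof (rule sum.cong)
  fix m assume "m \<in> Poly_Mapping.keys F"
  hence "(\<Sum>i\<in>UNIV. Poly_Mapping.lookup m i) = d"
    using assms by (auto simp: homogeneous_def)
  hence "(\<Prod>i\<in>UNIV. r ^ Poly_Mapping.lookup m i) = r ^ d"
    by (simp add: power_sum flip: power_sum)
  thus "to_ac (Poly_Mapping.lookup F m) * (\<Prod>i\<in>UNIV. (r *s v) $ i ^ Poly_Mapping.lookup m i) =
    r ^ d * (to_ac (Poly_Mapping.lookup F m) * (\<Prod>i\<in>UNIV. v $ i ^ Poly_Mapping.lookup m i))"
    by (simp add: power_mult_distrib prod.distrib mult_ac)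
qed simp

lemma eval_ac_on_line: "\<exists>R. \<forall>r. poly R r = eval_ac F (u + r *s w)"
  by (rule exI[of _ "\<Sum>m\<in>Poly_Mapping.keys F. [:to_ac (Poly_Mapping.lookup F m):] *
        (\<Prod>i\<in>UNIV. [:u $ i, w $ i:] ^ Poly_Mapping.lookup m i)"])
    (simp add: eval_ac_def poly_sum poly_prod)

lemma eval_ac_on_plane:
  assumes "homogeneous d F"
  obtains G where "total_degree_le d G"
    "\<And>s c. poly (poly G [:s:]) c = eval_ac F (s *s P + A + c *s B)"
proof -
  \<comment> \<open>Each coordinate becomes \<open>(A $ i + c * B $ i) + s * P $ i\<close>, of total
    degree at most 1, so a monomial of degree \<open>d\<close> becomes a product of \<open>d\<close>
    such factors.\<close>
  define G where "G = (\<Sum>m\<in>Poly_Mapping.keys F. [:[:to_ac (Poly_Mapping.lookup F m):]:] *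
        (\<Prod>i\<in>UNIV. [:[:A $ i, B $ i:], [:P $ i:]:] ^ Poly_Mapping.lookup m i))"
  have "total_degree_le d G"
    unfolding G_def
  proof (rule total_degree_le_sum)
    fix m assume "m \<in> Poly_Mapping.keys F"
    hence "(\<Sum>i\<in>UNIV. Poly_Mapping.lookup m i) = d"
      using assms by (auto simp: homogeneous_def)
    moreover have "total_degree_le (\<Sum>i\<in>UNIV. Poly_Mapping.lookup m i * 1)
        (\<Prod>i\<in>UNIV. [:[:A $ i, B $ i:], [:P $ i:]:] ^ Poly_Mapping.lookup m i)"
      by (intro total_degree_le_prod total_degree_le_power total_degree_le_linear)
    ultimately show "total_degree_le d ([:[:to_ac (Poly_Mapping.lookup F m):]:] *
        (\<Prod>i\<in>UNIV. [:[:A $ i, B $ i:], [:P $ i:]:] ^ Poly_Mapping.lookup m i))"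
      using total_degree_le_mult[OF total_degree_le_const] by fastforce
  qed
  moreover have "poly (poly G [:s:]) c = eval_ac F (s *s P + A + c *s B)" for s c
    by (simp add: G_def eval_ac_def poly_sum poly_prod algebra_simps)
  ultimately show ?thesis
    using that by blast
qed

lemma prod_UNIV_3: "prod f (UNIV :: 3 set) = f 1 * f 2 * f 3"
  unfolding UNIV_3 by (simp add: ac_simps)

text \<open>Kronecker substitution: \<open>x\<^sub>i = y ^ (N ^ i)\<close> sends distinct monomials with exponents
  below \<open>N\<close> to distinct powers of \<open>y\<close>.\<close>

lemma eval_ac_eq_0_imp_eq_0:
  fixes F :: "'k::field poly3"
  assumes "homogeneous d F" and zero: "\<And>v. eval_ac F v = 0"
  shows "F = 0"
proof (rule ccontr)
  assume "F \<noteq> 0"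
  then obtain m0 where m0: "m0 \<in> Poly_Mapping.keys F"
    by (metis all_not_in_conv keys_eq_empty)
  \<comment> \<open>By homogeneity no exponent exceeds \<open>d\<close>, so the exponents are digits
    in base \<open>d + 1\<close>.\<close>
  define N where "N = Suc d"
  define e where "e m = Poly_Mapping.lookup m 1 + N * (Poly_Mapping.lookup m 2
    + N * Poly_Mapping.lookup m (3::3))" for m :: "3 \<Rightarrow>\<^sub>0 nat"
  have bound: "Poly_Mapping.lookup m i < N" if "m \<in> Poly_Mapping.keys F" for m and i :: 3
  proof -
    have "Poly_Mapping.lookup m i \<le> (\<Sum>i\<in>UNIV. Poly_Mapping.lookup m i)"
      by (rule member_le_sum) auto
    also have "\<dots> = d"
      using assms that by (auto simp: homogeneous_def)
    finally show ?thesis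
      by (simp add: N_def)
  qed
  \<comment> \<open>Splits off the lowest base-\<open>N\<close> digit; two applications recover all
    three exponents from \<open>e\<close>.\<close>
  have digit: "a = a' \<and> b = b'" if "a + N * b = a' + N * b'" "a < N" "a' < N" for a a' b b'
  proof -
    have "a = (a + N * b) mod N" "a' = (a' + N * b') mod N"
      using that(2,3) by simp_all
    hence "a = a'"
      using that(1) by metis
    moreover have "N * b = N * b'"
      using that(1) \<open>a = a'\<close> by simp
    hence "b = b'"
      unfolding N_def by (metis Suc_mult_cancel1)
    ultimately show ?thesis ..
  qed
  have e_inj: "m = m'" if "m \<in> Poly_Mapping.keys F" "m' \<in> Poly_Mapping.keys F" "e m = e m'" for m m'
  proof -
    have "Poly_Mapping.lookup m 1 = Poly_Mapping.lookup m' 1 \<and>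
        Poly_Mapping.lookup m 2 + N * Poly_Mapping.lookup m 3 =
        Poly_Mapping.lookup m' 2 + N * Poly_Mapping.lookup m' 3"
      using that bound unfolding e_def by (intro digit) auto
    moreover from this have "Poly_Mapping.lookup m 2 = Poly_Mapping.lookup m' 2 \<and>
        Poly_Mapping.lookup m 3 = Poly_Mapping.lookup m' 3"
      using that bound by (intro digit) auto
    ultimately have "\<forall>i. Poly_Mapping.lookup m i = Poly_Mapping.lookup m' i"
      by (simp add: forall_3)
    thus ?thesis
      by (intro poly_mapping_eqI) simp
  qed
  define p where "p = (\<Sum>m\<in>Poly_Mapping.keys F. monom (to_ac (Poly_Mapping.lookup F m)) (e m))"
  have "poly p y = eval_ac F (vector [y, y ^ N, y ^ (N * N)])" for y
    by (simp add: p_def eval_ac_def poly_sum poly_monom prod_UNIV_3 e_def flip: power_mult power_add)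
      (simp add: algebra_simps)
  hence "p = 0"
    by (intro poly_eq_0_if_cofinite_roots[of "{}"]) (auto simp: zero)
  moreover have "coeff p (e m0) = to_ac (Poly_Mapping.lookup F m0)"
  proof -
    have "coeff p (e m0) = (\<Sum>m\<in>Poly_Mapping.keys F. if m = m0 then to_ac (Poly_Mapping.lookup F m) else 0)"
      unfolding p_def coeff_sum coeff_monom
      by (rule sum.cong) (use e_inj m0 in auto)
    thus ?thesis
      using m0 by simp
  qed
  ultimately show False
    using m0 by (simp add: in_keys_iff)
qed

section \<open>Finite fields\<close>

text \<open>The characteristic divides the cardinality, a power of the prime below \<open>q\<close>,
  hence equals that prime; the freshman's dream then holds in the field and in its closure.\<close>

lemma frobenius_add:
  fixes q :: nat
  assumes "primepow q" "CARD('k::{finite,field}) = q ^ 2"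
  shows "(x + y :: 'k) ^ q = x ^ q + y ^ q"
    and "(v + w :: 'k alg_closure) ^ q = v ^ q + w ^ q"
proof -
  obtain p n where p: "prime p" "n > 0" "q = p ^ n"
    using assms(1) by (auto simp: primepow_def)
  have char: "prime CHAR('k)"
    using prime_CHAR_semidom finite_imp_CHAR_pos[where ?'a = 'k] by auto
  moreover have "CHAR('k) dvd p ^ (n * 2)"
    using CHAR_dvd_CARD[where ?'a = 'k] assms(2) p by (simp add: power_mult)
  ultimately have "CHAR('k) = p"
    using p(1) by (metis prime_dvd_power primes_dvd_imp_eq)
  thus "(x + y) ^ q = x ^ q + y ^ q" "(v + w) ^ q = v ^ q + w ^ q"
    using char p by (auto intro!: freshmans_dream')
qed

text \<open>Multiplication by \<open>x\<close> permutes the units, so their product absorbs the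
  factor \<open>x ^ (CARD('k) - 1)\<close> unchanged.\<close>

lemma power_card_minus_1_eq_1:
  fixes x :: "'k::{finite,field}"
  assumes "x \<noteq> 0"
  shows "x ^ (CARD('k) - 1) = 1"
proof -
  let ?U = "UNIV - {0 :: 'k}"
  have "bij_betw ((*) x) ?U ?U"
    by (rule bij_betwI[of _ _ _ "\<lambda>y. y / x"]) (use assms in auto)
  hence "\<Prod>?U = (\<Prod>y\<in>?U. x * y)"
    using prod.reindex_bij_betw[of "(*) x" ?U ?U "\<lambda>y. y"] by simp
  also have "\<dots> = x ^ (CARD('k) - 1) * \<Prod>?U"
    by (simp add: prod.distrib card_Diff_singleton)
  finally show ?thesis
    by auto
qed

lemma card_roots_of_power_le:
  fixes a :: "'a::field"
  assumes "n > 0"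
  shows "finite {x. x ^ n = a}" "card {x. x ^ n = a} \<le> n"
proof -
  define p where "p = monom 1 n - [:a:]"
  have deg: "degree p = n"
    using assms unfolding p_def diff_conv_add_uminus
    by (subst degree_add_eq_left) (auto simp: degree_monom_eq)
  have p: "p \<noteq> 0"
    using deg assms by auto
  have eq: "{x. poly p x = 0} = {x. x ^ n = a}"
    by (auto simp: p_def poly_monom)
  show "finite {x. x ^ n = a}"
    using poly_roots_finite[OF p] by (simp add: eq)
  show "card {x. x ^ n = a} \<le> n"
    using card_poly_roots_bound[OF p] by (simp add: eq deg)
qed

text \<open>The fibres of the norm \<open>c \<mapsto> c\<^sup>q\<^sup>+\<^sup>1\<close> have at most \<open>q + 1\<close> elements and there are at most \<open>q - 1\<close> of
  them, so all \<open>q\<^sup>2 - 1\<close> units are accounted for only if each fibre is full.\<close>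

lemma card_norm_fibre:
  fixes \<gamma> :: "'k::{finite,field}"
  assumes card: "CARD('k) = q ^ 2" and q: "q \<ge> 2" and \<gamma>: "\<gamma> \<noteq> 0" "\<gamma> ^ q = \<gamma>"
  shows "card {c. c ^ (q + 1) = \<gamma>} = q + 1"
proof -
  \<comment> \<open>\<open>N\<close> contains every norm of a unit, since units satisfy
    \<open>c ^ (q ^ 2 - 1) = 1\<close>.\<close>
  define N where "N = {x :: 'k. x ^ (q - 1) = 1}"
  define fibre where "fibre x = {c :: 'k. c ^ (q + 1) = x}" for x
  have fibre_le: "card (fibre x) \<le> q + 1" for x
    unfolding fibre_def by (rule card_roots_of_power_le) simp
  have N_le: "card N \<le> q - 1"
    unfolding N_def by (rule card_roots_of_power_le) (use q in simp)
  have "\<gamma> * \<gamma> ^ (q - 1) = \<gamma> * 1"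
    using \<gamma>(2) q by (simp flip: power_Suc)
  hence \<gamma>_N: "\<gamma> \<in> N"
    using \<gamma>(1) by (simp add: N_def)
  have card_eq: "q ^ 2 - 1 = (q + 1) * (q - 1)"
    by (simp add: power2_eq_square algebra_simps)
  have "UNIV - {0} \<subseteq> (\<Union>x\<in>N. fibre x)"
  proof
    fix c :: 'k assume "c \<in> UNIV - {0}"
    hence "c ^ ((q + 1) * (q - 1)) = 1"
      using power_card_minus_1_eq_1[of c] card card_eq by simp
    hence "(c ^ (q + 1)) ^ (q - 1) = 1"
      by (simp only: power_mult)
    thus "c \<in> (\<Union>x\<in>N. fibre x)"
      by (auto simp: N_def fibre_def)
  qed
  hence "card (UNIV - {0 :: 'k}) \<le> card (\<Union>x\<in>N. fibre x)"
    by (intro card_mono) auto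
  also have "\<dots> \<le> (\<Sum>x\<in>N. card (fibre x))"
    by (rule card_UN_le) simp
  also have "\<dots> = card (fibre \<gamma>) + (\<Sum>x\<in>N - {\<gamma>}. card (fibre x))"
    by (rule sum.remove) (use \<gamma>_N in auto)
  also have "(\<Sum>x\<in>N - {\<gamma>}. card (fibre x)) \<le> (card N - 1) * (q + 1)"
    using sum_bounded_above[of "N - {\<gamma>}" "\<lambda>x. card (fibre x)" "q + 1"] fibre_le \<gamma>_N
    by (simp add: card_Diff_singleton)
  also have "\<dots> \<le> (q - 2) * (q + 1)"
    using N_le by (intro mult_right_mono) auto
  finally have le: "q ^ 2 - 1 \<le> card (fibre \<gamma>) + (q - 2) * (q + 1)"
    using card by (simp add: card_Diff_singleton)
  \<comment> \<open>Removes the truncated subtractions; what is left for the fibre of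
    \<open>\<gamma>\<close> is \<open>(q ^ 2 - 1) - (q - 2) * (q + 1) = q + 1\<close>.\<close>
  obtain k where k: "q = k + 2"
    using q by (metis add.commute le_Suc_ex)
  have "q + 1 \<le> card (fibre \<gamma>)"
    using le unfolding k by (simp add: power2_eq_square algebra_simps)
  with fibre_le[of \<gamma>] show ?thesis
    unfolding fibre_def by (rule le_antisym)
qed

section \<open>Hermitian forms of rank 2\<close>

text \<open>Stated over any field, so that it applies to \<open>H\<close> on rational vectors and to
  \<open>ac_mat H\<close> over the closure. Its diagonal is the equation of the Hermitian
  curve.\<close>

definition sesq :: "nat \<Rightarrow> 'a::field ^ 3 ^ 3 \<Rightarrow> 'a ^ 3 \<Rightarrow> 'a ^ 3 \<Rightarrow> 'a" where
  "sesq q H v w = (\<Sum>i\<in>UNIV. \<Sum>j\<in>UNIV. H $ i $ j * v $ i * w $ j ^ q)"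

lemma sesq_add_left: "sesq q H (u + v) w = sesq q H u w + sesq q H v w"
  by (simp add: sesq_def algebra_simps sum.distrib)

lemma sesq_scale_left: "sesq q H (r *s v) w = r * sesq q H v w"
  by (simp add: sesq_def sum_distrib_left algebra_simps)

lemma sesq_scale_right: "sesq q H v (r *s w) = r ^ q * sesq q H v w"
  by (simp add: sesq_def sum_distrib_left algebra_simps power_mult_distrib)

lemma sesq_add_right:
  fixes H :: "'a::field ^ 3 ^ 3"
  assumes "\<And>x y :: 'a. (x + y) ^ q = x ^ q + y ^ q"
  shows "sesq q H v (u + w) = sesq q H v u + sesq q H v w"
  by (simp add: sesq_def assms algebra_simps sum.distrib)

lemma sesq_axis:
  fixes H :: "'a::field ^ 3 ^ 3"
  assumes "q > 0"
  shows "sesq q H v (axis j 1) = (\<Sum>i\<in>UNIV. v $ i * H $ i $ j)"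
proof -
  have "H $ i $ j' * v $ i * axis j 1 $ j' ^ q = (if j' = j then v $ i * H $ i $ j' else 0)" for i j'
    using assms by (simp add: axis_def power_0_left)
  thus ?thesis
    by (simp add: sesq_def)
qed

lemma frobenius_sum:
  fixes f :: "'b \<Rightarrow> 'a::comm_semiring_1"
  assumes "\<And>x y :: 'a. (x + y) ^ q = x ^ q + y ^ q" "q > 0"
  shows "(\<Sum>i\<in>S. f i) ^ q = (\<Sum>i\<in>S. f i ^ q)"
  using assms by (induction S rule: infinite_finite_induct) (auto simp: power_0_left)

text \<open>The \<open>q\<close>-th power puts Frobenius on the first argument and, by
  \<open>(x ^ q) ^ q = x\<close>, removes it from the second; Hermitian symmetry of \<open>H\<close>
  exchanges the indices.\<close>

lemma sesq_conj:
  fixes H :: "'a::field ^ 3 ^ 3"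
  assumes frob: "\<And>x y :: 'a. (x + y) ^ q = x ^ q + y ^ q" and "q > 0"
    and card: "\<And>x :: 'a. (x ^ q) ^ q = x" and H: "hermitian_matrix q H"
  shows "sesq q H w v = sesq q H v w ^ q"
proof -
  have H': "(H $ i $ j) ^ q = H $ j $ i" for i j
    using H unfolding hermitian_matrix_def by metis
  have "sesq q H v w ^ q = (\<Sum>i\<in>UNIV. \<Sum>j\<in>UNIV. (H $ i $ j * v $ i * w $ j ^ q) ^ q)"
    unfolding sesq_def frobenius_sum[OF frob \<open>q > 0\<close>] ..
  also have "\<dots> = (\<Sum>i\<in>UNIV. \<Sum>j\<in>UNIV. H $ j $ i * w $ j * (v $ i) ^ q)"
    by (simp only: power_mult_distrib H' card mult_ac)
  also have "\<dots> = sesq q H w v"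
    unfolding sesq_def by (rule sum.swap)
  finally show ?thesis ..
qed

text \<open>\<open>x + x ^ q\<close> has degree \<open>q\<close>, hence too few roots to vanish on
  \<open>q ^ 2\<close> elements.\<close>

lemma exists_nonzero_trace:
  assumes "CARD('k::{finite,field}) = q ^ 2" "q \<ge> 2"
  shows "\<exists>l :: 'k. l + l ^ q \<noteq> 0"
proof (rule ccontr)
  assume "\<nexists>l :: 'k. l + l ^ q \<noteq> 0"
  hence zero: "l + l ^ q = 0" for l :: 'k
    by blast
  define p where "p = monom 1 q + monom (1 :: 'k) 1"
  have deg: "degree p = q"
    unfolding p_def using assms(2) by (subst degree_add_eq_left) (auto simp: degree_monom_eq)
  hence "p \<noteq> 0"
    using assms(2) by auto
  moreover have "{x. poly p x = 0} = UNIV"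
    using zero by (auto simp: p_def poly_monom add.commute)
  ultimately have "q ^ 2 \<le> q"
    using card_poly_roots_bound[of p] deg assms(1) by simp
  thus False
    using assms(2) by (simp add: power2_eq_square)
qed

text \<open>Polarisation without dividing by 2: if all vectors were isotropic, expanding at
  \<open>v + w\<close> would make every value of the form have trace zero. Rescaling
  \<open>v\<close> turns a nonzero value into an element of nonzero trace.\<close>

lemma exists_anisotropic:
  fixes H :: "'k::{finite,field} ^ 3 ^ 3"
  assumes card: "CARD('k) = q ^ 2" and q: "q \<ge> 2"
    and frob: "\<And>x y :: 'k. (x + y) ^ q = x ^ q + y ^ q"
    and conj: "\<And>v w. sesq q H w v = sesq q H v w ^ q"
    and "H \<noteq> 0"
  shows "\<exists>B. sesq q H B B \<noteq> 0"
proof (rule ccontr)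
  assume "\<nexists>B. sesq q H B B \<noteq> 0"
  hence iso: "sesq q H v v = 0" for v
    by blast
  have trace: "sesq q H v w + sesq q H v w ^ q = 0" for v w
  proof -
    have "sesq q H v w + sesq q H w v = 0"
      using iso[of "v + w"] by (simp add: sesq_add_left sesq_add_right[OF frob] iso)
    thus ?thesis
      by (simp only: conj[of w v])
  qed
  have zero: "sesq q H v w = 0" for v w
  proof (rule ccontr)
    assume nz: "sesq q H v w \<noteq> 0"
    obtain l :: 'k where "l + l ^ q \<noteq> 0"
      using exists_nonzero_trace[OF card q] by blast
    thus False
      using trace[of "(l / sesq q H v w) *s v" w] nz by (simp add: sesq_scale_left)
  qed
  have "H $ i $ j = 0" for i j
  proof -
    have "axis i (1 :: 'k) $ k * H $ k $ j = (if k = i then H $ k $ j else 0)" for k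
      by (simp add: axis_def)
    hence "sesq q H (axis i 1) (axis j 1) = H $ i $ j"
      using q by (subst sesq_axis) simp_all
    thus ?thesis
      using zero by simp
  qed
  thus False
    using \<open>H \<noteq> 0\<close> by (simp add: vec_eq_iff)
qed

text \<open>Supplies the vertex: the coefficients of a linear dependence between the rows are the
  entries of \<open>P\<close>.\<close>

lemma rank_lt_3_imp_left_kernel:
  fixes H :: "'a::field ^ 3 ^ 3"
  assumes "rank H < 3"
  obtains P where "P \<noteq> 0" "\<And>j. (\<Sum>i\<in>UNIV. P $ i * H $ i $ j) = 0"
proof -
  have "vec.span (rows H) \<noteq> UNIV"
  proof
    assume "vec.span (rows H) = UNIV"
    hence "vec.dim (rows H) = vec.dim (UNIV :: ('a ^ 3) set)"
      using vec.dim_span[of "rows H"] by simp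
    thus False
      using assms by (simp add: row_rank_def_gen vec.dim_UNIV card_cart_basis)
  qed
  hence "\<nexists>N. H ** N = mat 1"
    using matrix_left_right_inverse[of H] matrix_left_invertible_span_rows_gen[of H] by blast
  then obtain c where c: "(\<Sum>i\<in>UNIV. c i *s row i H) = 0" "\<exists>i. c i \<noteq> 0"
    by (auto simp: matrix_right_invertible_independent_rows)
  have "(\<Sum>i\<in>UNIV. (\<chi> i. c i) $ i * H $ i $ j) = (\<Sum>i\<in>UNIV. c i *s row i H) $ j" for j
    by (simp add: row_def)
  moreover have "(\<chi> i. c i) \<noteq> 0"
    using c(2) by (auto simp: vec_eq_iff)
  ultimately show ?thesis
    by (intro that[of "\<chi> i. c i"]) (simp_all only: c(1) zero_index not_False_eq_True)
qed

lemma exists_not_in_span_pair: "\<exists>v :: 'a::field ^ 3. v \<notin> vec.span {u, w}"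
proof (rule ccontr)
  assume "\<nexists>v. v \<notin> vec.span {u, w}"
  hence "vec.span {u, w} = UNIV"
    by blast
  hence "vec.dim {u, w} = vec.dim (UNIV :: ('a ^ 3) set)"
    using vec.dim_span[of "{u, w}"] by simp
  moreover have "vec.dim {u, w} \<le> 2"
    using vec.dim_le_card'[of "{u, w}"] card_insert_le_m1[of 2 "{w}" u] by auto
  ultimately show False
    by (simp add: vec.dim_UNIV card_cart_basis)
qed

lemma span_pairI: "r *s u + t *s w \<in> vec.span {u, w}"
  by (intro vec.span_add vec.span_scale vec.span_base) auto

text \<open>Modulo the kernel vectors \<open>P\<close> and \<open>A\<close>, each unit vector is a
  multiple of \<open>B\<close>, so each row of \<open>H\<close> is a multiple of the single row
  \<open>\<rho>\<close>.\<close>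

lemma rank_le_1_of_kernel:
  fixes H :: "'a::field ^ 3 ^ 3"
  assumes P: "\<And>j. (\<Sum>i\<in>UNIV. P $ i * H $ i $ j) = 0"
    and A: "\<And>j. (\<Sum>i\<in>UNIV. A $ i * H $ i $ j) = 0"
    and gen: "\<And>v. \<exists>u x y. v = u *s P + x *s A + y *s B"
  shows "rank H \<le> 1"
proof -
  define \<rho> where "\<rho> = (\<chi> j. \<Sum>i\<in>UNIV. B $ i * H $ i $ j)"
  have "rows H \<subseteq> vec.span {\<rho>}"
  proof
    fix r assume "r \<in> rows H"
    then obtain k where k: "r = row k H"
      by (auto simp: rows_def)
    obtain u x y where e: "axis k 1 = u *s P + x *s A + y *s B"
      using gen by blast
    have "r $ j = y * \<rho> $ j" for j
    proof -
      have "r $ j = (\<Sum>i\<in>UNIV. axis k 1 $ i * H $ i $ j)"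
      proof -
        have "axis k (1 :: 'a) $ i * H $ i $ j = (if i = k then H $ i $ j else 0)" for i
          by (simp add: axis_def)
        thus ?thesis
          by (simp add: k row_def)
      qed
      also have "\<dots> = u * (\<Sum>i\<in>UNIV. P $ i * H $ i $ j) + x * (\<Sum>i\<in>UNIV. A $ i * H $ i $ j)
          + y * (\<Sum>i\<in>UNIV. B $ i * H $ i $ j)"
        by (simp add: e sum_distrib_left algebra_simps sum.distrib)
      finally show ?thesis
        by (simp add: P A \<rho>_def)
    qed
    hence "r = y *s \<rho>"
      by (simp add: vec_eq_iff)
    thus "r \<in> vec.span {\<rho>}"
      by (simp add: vec.span_base vec.span_scale)
  qed
  hence "vec.dim (rows H) \<le> vec.dim {\<rho>}"
    using vec.dim_subset[of "rows H" "vec.span {\<rho>}"] by (simp only: vec.dim_span)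
  also have "\<dots> \<le> 1"
    using vec.dim_le_card'[of "{\<rho>}"] by simp
  finally show ?thesis
    by (simp add: row_rank_def_gen)
qed

section \<open>Extension of scalars and diagonalisation of the form\<close>

definition ac_vec :: "'k::field ^ 'n \<Rightarrow> 'k alg_closure ^ 'n" where
  "ac_vec v = (\<chi> i. to_ac (v $ i))"

definition ac_mat :: "'k::field ^ 'n ^ 'm \<Rightarrow> 'k alg_closure ^ 'n ^ 'm" where
  "ac_mat M = (\<chi> i j. to_ac (M $ i $ j))"

lemma ac_vec_eq_0_iff [simp]: "ac_vec v = 0 \<longleftrightarrow> v = 0"
  by (simp add: ac_vec_def vec_eq_iff)

lemma ac_mat_mult_ac_vec: "ac_mat M *v ac_vec v = ac_vec (M *v v)"
  by (simp add: ac_mat_def ac_vec_def matrix_vector_mult_def vec_eq_iff to_ac_sum)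

lemma ac_mat_mult: "ac_mat M ** ac_mat N = ac_mat (M ** N)"
  by (simp add: ac_mat_def matrix_matrix_mult_def vec_eq_iff to_ac_sum)

lemma ac_mat_1: "ac_mat (mat 1) = mat 1"
  by (simp add: ac_mat_def mat_def vec_eq_iff)

lemma sesq_ac_mat: "sesq q (ac_mat H) (ac_vec v) (ac_vec w) = to_ac (sesq q H v w)"
  by (simp add: ac_mat_def ac_vec_def sesq_def to_ac_sum)

lemma sesq_eq_sum_left_kernel:
  "sesq q H v w = (\<Sum>j\<in>UNIV. (\<Sum>i\<in>UNIV. v $ i * H $ i $ j) * w $ j ^ q)"
  unfolding sesq_def by (subst sum.swap) (simp add: sum_distrib_left sum_distrib_right mult_ac)

definition matrix_of_columns :: "'a ^ 3 \<Rightarrow> 'a ^ 3 \<Rightarrow> 'a ^ 3 \<Rightarrow> 'a::zero ^ 3 ^ 3" where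
  "matrix_of_columns P A B = (\<chi> i j. vector [P $ i, A $ i, B $ i] $ j)"

lemma matrix_of_columns_mult_vec:
  fixes P A B :: "'a::field ^ 3"
  shows "matrix_of_columns P A B *v v = v $ 1 *s P + v $ 2 *s A + v $ 3 *s B"
  by (simp add: matrix_of_columns_def vec_eq_iff matrix_vector_mult_def sum_3 algebra_simps)

lemma ac_mat_matrix_of_columns:
  "ac_mat (matrix_of_columns P A B) = matrix_of_columns (ac_vec P) (ac_vec A) (ac_vec B)"
  by (simp add: ac_mat_def ac_vec_def matrix_of_columns_def vec_eq_iff forall_3)

lemma matrix_of_columns_left_inverse:
  fixes P A B :: "'a::field ^ 3"
  assumes "\<And>u x y. u *s P + x *s A + y *s B = 0 \<Longrightarrow> u = 0 \<and> x = 0 \<and> y = 0"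
  shows "\<exists>N. N ** matrix_of_columns P A B = mat 1"
  unfolding matrix_left_invertible_ker matrix_of_columns_mult_vec
proof (intro allI impI)
  fix v :: "'a ^ 3" assume "v $ 1 *s P + v $ 2 *s A + v $ 3 *s B = 0"
  from assms[OF this] show "v = 0"
    unfolding vec_eq_iff forall_3 zero_index .
qed

text \<open>Gram-Schmidt: \<open>P\<close> spans the radical, \<open>B\<close> is anisotropic, and
  \<open>A\<close> is a vector outside their span with its \<open>B\<close>-component removed.
  Conjugate symmetry puts the diagonal values into the fixed field of Frobenius.\<close>

lemma hermitian_orthogonal_basis:
  fixes H :: "'k::{finite,field} ^ 3 ^ 3"
  assumes q: "primepow q" and card: "CARD('k) = q ^ 2"
    and H: "hermitian_matrix q H" and rank: "rank H = 2"
  obtains P A B where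
    "\<And>u x y. u *s P + x *s A + y *s B = 0 \<Longrightarrow> u = 0 \<and> x = 0 \<and> y = 0"
    "\<And>w. sesq q H P w = 0" "\<And>w. sesq q H w P = 0"
    "sesq q H A B = 0" "sesq q H B A = 0"
    "sesq q H A A ^ q = sesq q H A A" "sesq q H B B ^ q = sesq q H B B"
    "sesq q H A A \<noteq> 0" "sesq q H B B \<noteq> 0"
proof -
  have q2: "q \<ge> 2"
    using primepow_gt_Suc_0[OF q] by simp
  note frob = frobenius_add(1)[OF q card]
  have pow: "(x ^ q) ^ q = x" for x :: 'k
  proof (cases "x = 0")
    case False
    have "(x ^ q) ^ q = x ^ CARD('k)"
      by (simp only: card power2_eq_square power_mult)
    also have "\<dots> = x ^ (CARD('k) - 1) * x"
      by (rule power_minus_mult[symmetric]) simp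
    finally show ?thesis
      using power_card_minus_1_eq_1[OF False] by simp
  qed (use q2 in \<open>simp add: power_0_left\<close>)
  have conj: "sesq q H w v = sesq q H v w ^ q" for v w
    using q2 by (intro sesq_conj frob pow H) auto
  obtain P where P: "P \<noteq> 0" "\<And>j. (\<Sum>i\<in>UNIV. P $ i * H $ i $ j) = 0"
    using rank_lt_3_imp_left_kernel[of H] rank by auto
  have P_left: "sesq q H P w = 0" for w
    by (simp add: sesq_eq_sum_left_kernel P)
  have P_right: "sesq q H w P = 0" for w
    using conj[of w P] P_left[of w] q2 by (simp add: power_0_left)
  have "H \<noteq> 0"
  proof
    assume "H = 0"
    hence "rows H \<subseteq> {0}"
      by (auto simp: rows_def row_def vec_eq_iff)
    hence "vec.dim (rows H) = 0"
      by (simp only: vec.dim_eq_0)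
    thus False
      using rank unfolding row_rank_def_gen by linarith
  qed
  then obtain B where B: "sesq q H B B \<noteq> 0"
    using exists_anisotropic[OF card q2 frob conj] by blast
  obtain A0 where A0: "A0 \<notin> vec.span {P, B}"
    using exists_not_in_span_pair by blast
  define A where "A = A0 + (- (sesq q H A0 B / sesq q H B B)) *s B"
  have AB: "sesq q H A B = 0"
    using B unfolding A_def by (simp only: sesq_add_left sesq_scale_left) simp
  have BA: "sesq q H B A = 0"
    using conj[of B A] AB q2 by (simp add: power_0_left)
  have A: "A \<notin> vec.span {P, B}"
  proof
    assume "A \<in> vec.span {P, B}"
    moreover have "(sesq q H A0 B / sesq q H B B) *s B \<in> vec.span {P, B}"
      by (intro vec.span_scale vec.span_base) simp
    ultimately have "A + (sesq q H A0 B / sesq q H B B) *s B \<in> vec.span {P, B}"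
      by (rule vec.span_add)
    also have "A + (sesq q H A0 B / sesq q H B B) *s B = A0"
      by (simp add: A_def vec_eq_iff)
    finally show False
      using A0 by simp
  qed
  have indep: "u = 0 \<and> x = 0 \<and> y = 0" if rel: "u *s P + x *s A + y *s B = 0" for u x y
  proof -
    have "x = 0"
    proof (rule ccontr)
      assume "x \<noteq> 0"
      have "A $ i = (- u / x) * P $ i + (- y / x) * B $ i" for i
      proof -
        have "u * P $ i + x * A $ i + y * B $ i = (u *s P + x *s A + y *s B) $ i"
          by (simp only: vector_add_component vector_smult_component)
        hence "x * A $ i = - (u * P $ i + y * B $ i)"
          unfolding rel zero_index by (simp only: eq_neg_iff_add_eq_0 ac_simps)
        hence "A $ i = - (u * P $ i + y * B $ i) / x"
          by (subst nonzero_eq_divide_eq[OF \<open>x \<noteq> 0\<close>]) (simp only: mult.commute)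
        thus ?thesis
          by (simp add: add_divide_distrib diff_divide_distrib)
      qed
      hence "A = (- u / x) *s P + (- y / x) *s B"
        by (simp add: vec_eq_iff)
      hence "A \<in> vec.span {P, B}"
        by (simp only: span_pairI)
      with A show False ..
    qed
    have "sesq q H (u *s P + x *s A + y *s B) B = 0"
      unfolding rel by (simp add: sesq_def)
    hence "y = 0"
      using B by (simp add: sesq_add_left sesq_scale_left P_left AB)
    with \<open>x = 0\<close> rel P(1) show ?thesis
      by simp
  qed
  have "sesq q H A A \<noteq> 0"
  proof
    \<comment> \<open>An isotropic \<open>A\<close> would be orthogonal to the whole basis, giving a
      second kernel vector and rank at most 1.\<close>
    assume AA: "sesq q H A A = 0"
    obtain N where "N ** matrix_of_columns P A B = mat 1"
      using matrix_of_columns_left_inverse[OF indep] by blast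
    hence "matrix_of_columns P A B ** N = mat 1"
      by (simp add: matrix_left_right_inverse)
    hence "v = matrix_of_columns P A B *v (N *v v)" for v
      by (simp add: matrix_vector_mul_assoc)
    hence gen: "\<exists>u x y. v = u *s P + x *s A + y *s B" for v
      unfolding matrix_of_columns_mult_vec by (intro exI)
    have "sesq q H A w = 0" for w
    proof -
      obtain u x y where "w = u *s P + x *s A + y *s B"
        using gen by blast
      thus ?thesis
        by (simp add: sesq_add_right[OF frob] sesq_scale_right P_right AA AB)
    qed
    hence "(\<Sum>i\<in>UNIV. A $ i * H $ i $ j) = 0" for j
      using sesq_axis[of q H A j] q2 by simp
    hence "rank H \<le> 1"
      by (rule rank_le_1_of_kernel[OF P(2) _ gen])
    thus False
      using rank by simp
  qed
  moreover have "sesq q H A A ^ q = sesq q H A A" "sesq q H B B ^ q = sesq q H B B"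
    by (simp_all only: conj[of A A, symmetric] conj[of B B, symmetric])
  ultimately show ?thesis
    by (intro that[of P A B] indep P_left P_right AB BA B)
qed

text \<open>The columns of \<open>M\<close> are the orthogonal basis. \<open>sesq\<close> at
  rational vectors is the image of its value over the ground field, so the cross terms vanish over
  the closure too.\<close>

lemma hermitian_normal_form:
  fixes H :: "'k::{finite,field} ^ 3 ^ 3"
  assumes q: "primepow q" and card: "CARD('k) = q ^ 2"
    and H: "hermitian_matrix q H" and rank: "rank H = 2"
  obtains M N :: "'k ^ 3 ^ 3" and \<alpha> \<beta> where "M ** N = mat 1" "N ** M = mat 1"
    "\<alpha> \<noteq> 0" "\<beta> \<noteq> 0" "\<alpha> ^ q = \<alpha>" "\<beta> ^ q = \<beta>"
    "\<And>v. sesq q (ac_mat H) (ac_mat M *v v) (ac_mat M *v v) =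
       to_ac \<alpha> * v $ 2 ^ (q + 1) + to_ac \<beta> * v $ 3 ^ (q + 1)"
proof -
  obtain P A B where basis:
    "\<And>u x y. u *s P + x *s A + y *s B = 0 \<Longrightarrow> u = 0 \<and> x = 0 \<and> y = 0"
    "\<And>w. sesq q H P w = 0" "\<And>w. sesq q H w P = 0"
    "sesq q H A B = 0" "sesq q H B A = 0"
    "sesq q H A A ^ q = sesq q H A A" "sesq q H B B ^ q = sesq q H B B"
    "sesq q H A A \<noteq> 0" "sesq q H B B \<noteq> 0"
    using hermitian_orthogonal_basis[OF assms] by blast
  define M where "M = matrix_of_columns P A B"
  obtain N where NM: "N ** M = mat 1"
    using matrix_of_columns_left_inverse[OF basis(1)] unfolding M_def by blast
  note frob = frobenius_add(2)[OF q card]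
  have "sesq q (ac_mat H) (ac_mat M *v v) (ac_mat M *v v) =
       to_ac (sesq q H A A) * v $ 2 ^ (q + 1) + to_ac (sesq q H B B) * v $ 3 ^ (q + 1)" for v
    by (simp add: M_def ac_mat_matrix_of_columns matrix_of_columns_mult_vec sesq_add_left sesq_scale_left sesq_add_right[OF frob] sesq_scale_right
        sesq_ac_mat basis)
  thus ?thesis
    by (rule that[OF NM[unfolded matrix_left_right_inverse[of N M]] NM basis(8,9,6,7)])
qed

section \<open>Rational points on the pencil of lines\<close>

lemma proj_point_eq_iff:
  assumes "v \<noteq> 0"
  shows "proj_point v = proj_point w \<longleftrightarrow> (\<exists>r. r \<noteq> 0 \<and> w = r *s v)"
proof
  assume eq: "proj_point v = proj_point w"
  have "w \<in> proj_point w" "v \<in> proj_point v"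
    by (simp_all add: proj_point_def vec.span_base)
  hence "w \<in> proj_point v" "v \<in> proj_point w"
    using eq by simp_all
  then obtain r r' where r: "w = r *s v" "v = r' *s w"
    unfolding proj_point_def vec.span_singleton by blast
  have "r \<noteq> 0"
    using r assms by auto
  with r(1) show "\<exists>r. r \<noteq> 0 \<and> w = r *s v"
    by blast
next
  assume "\<exists>r. r \<noteq> 0 \<and> w = r *s v"
  then obtain r where r: "r \<noteq> 0" "w = r *s v"
    by blast
  have "k *s v = (k / r) *s w" for k
    using r by (simp add: vec_eq_iff)
  moreover have "k *s w = (k * r) *s v" for k
    using r by (simp add: vec_eq_iff)
  ultimately show "proj_point v = proj_point w"
    unfolding proj_point_def vec.span_singleton by blast
qed

text \<open>A locus only asks for some representative satisfying \<open>\<phi>\<close>; scale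
  invariance allows testing the given one.\<close>

lemma proj_point_mem_locus_iff:
  assumes "\<And>r w. r \<noteq> 0 \<Longrightarrow> \<phi> (r *s w) \<longleftrightarrow> \<phi> w" and "v \<noteq> 0"
  shows "proj_point v \<in> {proj_point w | w. w \<noteq> 0 \<and> \<phi> w} \<longleftrightarrow> \<phi> v"
proof
  assume "proj_point v \<in> {proj_point w | w. w \<noteq> 0 \<and> \<phi> w}"
  thus "\<phi> v"
    using assms by (auto simp: proj_point_eq_iff)
qed (use assms(2) in blast)

section \<open>Coordinates adapted to the pencil of lines\<close>

locale hermitian_pencil =
  fixes q d :: nat and H :: "'k::{finite,field} ^ 3 ^ 3" and F :: "'k poly3"
    and M N :: "'k ^ 3 ^ 3" and \<alpha> \<beta> :: 'k
  assumes q: "primepow q" and card_k: "CARD('k) = q ^ 2"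
    and d_pos: "1 \<le> d"
    and F_nz: "F \<noteq> 0" and hom: "homogeneous d F"
    and MN: "M ** N = mat 1" and NM: "N ** M = mat 1"
    and \<alpha>: "\<alpha> \<noteq> 0" "\<alpha> ^ q = \<alpha>" and \<beta>: "\<beta> \<noteq> 0" "\<beta> ^ q = \<beta>"
    and form: "\<And>v. sesq q (ac_mat H) (ac_mat M *v v) (ac_mat M *v v) =
       to_ac \<alpha> * v $ 2 ^ (q + 1) + to_ac \<beta> * v $ 3 ^ (q + 1)"
begin

text \<open>Coordinates along the columns of \<open>M\<close>: \<open>E 1 0 0\<close> represents the
  vertex, and in the chart \<open>x = 1\<close> the slope \<open>y\<close> selects a line through it
  and \<open>u\<close> a point on that line.\<close>

definition E :: "'k alg_closure \<Rightarrow> 'k alg_closure \<Rightarrow> 'k alg_closure \<Rightarrow> 'k alg_closure ^ 3" where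
  "E u x y = ac_mat M *v vector [u, x, y]"

definition coord :: "3 \<Rightarrow> 'k alg_closure ^ 3 \<Rightarrow> 'k alg_closure" where
  "coord i v = (ac_mat N *v v) $ i"

definition f :: "'k alg_closure \<Rightarrow> 'k alg_closure \<Rightarrow> 'k alg_closure \<Rightarrow> 'k alg_closure" where
  "f u x y = eval_ac F (E u x y)"

definition C :: "'k set" where
  "C = {c. c ^ (q + 1) = - \<alpha> / \<beta>}"

text \<open>Omits one line through the vertex, \<open>x = 0\<close>, which is not contained in the
  curve because \<open>\<beta>\<close> is nonzero.\<close>

definition pencil_line :: "'k alg_closure \<Rightarrow> ('k alg_closure ^ 3) set set" where
  "pencil_line c = {proj_point v | v. v \<noteq> 0 \<and> coord 3 v = c * coord 2 v}"

lemma q_ge_2: "q \<ge> 2"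
  using primepow_gt_Suc_0[OF q] by simp

lemma coord_E [simp]: "coord 1 (E u x y) = u" "coord 2 (E u x y) = x" "coord 3 (E u x y) = y"
  by (simp_all add: coord_def E_def matrix_vector_mul_assoc ac_mat_mult NM ac_mat_1)

lemma E_coord: "E (coord 1 v) (coord 2 v) (coord 3 v) = v"
proof -
  have "vector [coord 1 v, coord 2 v, coord 3 v] = ac_mat N *v v"
    by (simp add: coord_def vec_eq_iff forall_3)
  thus ?thesis
    by (simp add: E_def matrix_vector_mul_assoc ac_mat_mult MN ac_mat_1)
qed

lemma ex_E: "\<exists>u x y. v = E u x y"
  using E_coord[of v] by metis

lemma E_eq_iff: "E u x y = E u' x' y' \<longleftrightarrow> u = u' \<and> x = x' \<and> y = y'"
  by (metis coord_E)

lemma E_scale: "r *s E u x y = E (r * u) (r * x) (r * y)"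
proof -
  have "vector [r * u, r * x, r * y] = r *s (vector [u, x, y] :: 'k alg_closure ^ 3)"
    by (simp add: vec_eq_iff forall_3)
  thus ?thesis
    by (simp add: E_def vector_scalar_commute)
qed

lemma E_add: "E u x y + E u' x' y' = E (u + u') (x + x') (y + y')"
proof -
  have "vector [u + u', x + x', y + y'] =
      (vector [u, x, y] + vector [u', x', y'] :: 'k alg_closure ^ 3)"
    by (simp add: vec_eq_iff forall_3)
  thus ?thesis
    by (simp add: E_def matrix_vector_right_distrib)
qed

lemma E_0: "E 0 0 0 = 0"
  using E_scale[of 0 0 0 0] by simp

lemma E_eq_0_iff: "E u x y = 0 \<longleftrightarrow> u = 0 \<and> x = 0 \<and> y = 0"
  using E_eq_iff[of u x y 0 0 0] by (simp add: E_0)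

lemma coord_scale: "coord i (r *s v) = r * coord i v"
  by (simp add: coord_def vector_scalar_commute)

lemma f_scale: "f (r * u) (r * x) (r * y) = r ^ d * f u x y"
  unfolding f_def E_scale[symmetric] by (rule eval_ac_scale[OF hom])

lemma E_mem_zero_set_iff:
  assumes "E u x y \<noteq> 0"
  shows "proj_point (E u x y) \<in> zero_set F \<longleftrightarrow> f u x y = 0"
  unfolding zero_set_def f_def
  by (rule proj_point_mem_locus_iff) (use assms in \<open>simp_all add: eval_ac_scale[OF hom]\<close>)

lemma E_mem_pencil_line_iff:
  assumes "E u x y \<noteq> 0"
  shows "proj_point (E u x y) \<in> pencil_line c \<longleftrightarrow> y = c * x"
  unfolding pencil_line_def
  by (subst proj_point_mem_locus_iff) (use assms in \<open>simp_all add: coord_scale\<close>)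

lemma hermitian_curve_eq:
  "hermitian_curve q H = {proj_point v | v. v \<noteq> 0 \<and> sesq q (ac_mat H) v v = 0}"
  by (simp add: hermitian_curve_def sesq_def ac_mat_def)

text \<open>Additivity at \<open>x\<close> and \<open>- x\<close> covers odd and even
  \<open>q\<close> alike.\<close>

lemma uminus_power_q: "(- x :: 'k) ^ q = - (x ^ q)"
  using frobenius_add(1)[OF q card_k, of x "- x"] q_ge_2
  by (simp add: power_0_left eq_neg_iff_add_eq_0 add.commute)

lemma card_C: "card C = q + 1"
  unfolding C_def
  by (rule card_norm_fibre[OF card_k q_ge_2])
    (use \<alpha> \<beta> in \<open>simp_all add: power_divide uminus_power_q\<close>)

text \<open>The equation has at most \<open>q + 1\<close> roots in the closure and \<open>C\<close>
  already provides that many, so passing to the closure adds no slopes.\<close>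

lemma norm_eq_iff_mem_C:
  "to_ac \<alpha> + to_ac \<beta> * c ^ (q + 1) = 0 \<longleftrightarrow> c \<in> to_ac ` C"
proof -
  have "to_ac ` C \<subseteq> {c. c ^ (q + 1) = to_ac (- \<alpha> / \<beta>)}"
    by (auto simp: C_def simp del: to_ac_divide simp flip: to_ac_power to_ac_mult)
  moreover have "card {c. c ^ (q + 1) = to_ac (- \<alpha> / \<beta>)} \<le> card (to_ac ` C)"
    using card_roots_of_power_le(2)[of "q + 1" "to_ac (- \<alpha> / \<beta>)"]
    by (simp add: card_C card_image inj_on_def)
  ultimately have "to_ac ` C = {c. c ^ (q + 1) = to_ac (- \<alpha> / \<beta>)}"
    using card_roots_of_power_le(1)[of "q + 1"] by (intro card_seteq) auto
  moreover have "to_ac \<alpha> + to_ac \<beta> * c ^ (q + 1) = 0 \<longleftrightarrow> c ^ (q + 1) = to_ac (- \<alpha> / \<beta>)"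
    using \<beta> by (auto simp: field_simps eq_neg_iff_add_eq_0 neg_eq_iff_add_eq_0)
  ultimately show ?thesis
    by auto
qed

text \<open>Division by \<open>x ^ (q + 1)\<close> gives the norm equation for \<open>y / x\<close>.
  Requiring \<open>x \<noteq> 0\<close> keeps the vertex, common to all the lines, in a case of its
  own.\<close>

lemma E_mem_hermitian_curve_iff:
  assumes "E u x y \<noteq> 0"
  shows "proj_point (E u x y) \<in> hermitian_curve q H \<longleftrightarrow>
    x = 0 \<and> y = 0 \<or> (\<exists>c\<in>C. x \<noteq> 0 \<and> y = to_ac c * x)"
proof -
  have "proj_point (E u x y) \<in> hermitian_curve q H \<longleftrightarrow> sesq q (ac_mat H) (E u x y) (E u x y) = 0"
    unfolding hermitian_curve_eq
    by (rule proj_point_mem_locus_iff) (use assms in \<open>simp_all add: sesq_scale_left sesq_scale_right\<close>)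
  also have "sesq q (ac_mat H) (E u x y) (E u x y) = to_ac \<alpha> * x ^ (q + 1) + to_ac \<beta> * y ^ (q + 1)"
    unfolding E_def form by simp
  also have "\<dots> = 0 \<longleftrightarrow> x = 0 \<and> y = 0 \<or> (\<exists>c\<in>C. x \<noteq> 0 \<and> y = to_ac c * x)"
  proof (cases "x = 0")
    case True
    thus ?thesis using \<beta> by auto
  next
    case False
    have "to_ac \<alpha> * x ^ (q + 1) + to_ac \<beta> * y ^ (q + 1) =
        x ^ (q + 1) * (to_ac \<alpha> + to_ac \<beta> * (y / x) ^ (q + 1))"
      using False by (simp add: power_divide distrib_left)
    hence "to_ac \<alpha> * x ^ (q + 1) + to_ac \<beta> * y ^ (q + 1) = 0 \<longleftrightarrow> y / x \<in> to_ac ` C"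
      using False norm_eq_iff_mem_C[of "y / x"] by simp
    also have "\<dots> \<longleftrightarrow> (\<exists>c\<in>C. y = to_ac c * x)"
      using False by (auto simp: field_simps)
    finally show ?thesis
      using False by simp
  qed
  finally show ?thesis .
qed

section \<open>Lines contained in the Hermitian curve\<close>

lemma pencil_line_in_proj_lines: "pencil_line c \<in> proj_lines"
proof -
  define a where "a = (\<chi> i. ac_mat N $ 3 $ i - c * ac_mat N $ 2 $ i)"
  have dot: "(\<Sum>i\<in>UNIV. a $ i * v $ i) = coord 3 v - c * coord 2 v" for v
    by (simp add: a_def coord_def matrix_vector_mult_def sum_subtractf sum_distrib_left algebra_simps)
  have "a \<noteq> 0"
    using dot[of "E 0 0 1"] by auto
  moreover have "pencil_line c = {proj_point v | v. v \<noteq> 0 \<and> (\<Sum>i\<in>UNIV. a $ i * v $ i) = 0}"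
    by (simp add: pencil_line_def dot)
  ultimately show ?thesis
    unfolding proj_lines_def by blast
qed

lemma inj_pencil_line: "inj pencil_line"
proof (rule injI)
  fix c c' assume "pencil_line c = pencil_line c'"
  thus "c = c'"
    using E_mem_pencil_line_iff[of 0 1 c c] E_mem_pencil_line_iff[of 0 1 c c']
    by (simp add: E_eq_0_iff)
qed

lemma pencil_line_subset_iff:
  "pencil_line c \<subseteq> S \<longleftrightarrow> (\<forall>u x. E u x (c * x) \<noteq> 0 \<longrightarrow> proj_point (E u x (c * x)) \<in> S)"
proof
  assume "pencil_line c \<subseteq> S"
  thus "\<forall>u x. E u x (c * x) \<noteq> 0 \<longrightarrow> proj_point (E u x (c * x)) \<in> S"
    using E_mem_pencil_line_iff by blast
next
  assume S: "\<forall>u x. E u x (c * x) \<noteq> 0 \<longrightarrow> proj_point (E u x (c * x)) \<in> S"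
  show "pencil_line c \<subseteq> S"
  proof
    fix p assume "p \<in> pencil_line c"
    then obtain v where v: "p = proj_point v" "v \<noteq> 0" "coord 3 v = c * coord 2 v"
      unfolding pencil_line_def by blast
    have "v = E (coord 1 v) (coord 2 v) (c * coord 2 v)"
      using E_coord[of v] v(3) by simp
    with v S show "p \<in> S"
      by metis
  qed
qed

lemma pencil_line_subset_hermitian_curve:
  assumes "c \<in> C"
  shows "pencil_line (to_ac c) \<subseteq> hermitian_curve q H"
  unfolding pencil_line_subset_iff using assms by (auto simp: E_mem_hermitian_curve_iff)

text \<open>Let \<open>b\<close> be the linear form of the line in the new coordinates. If
  \<open>b 1\<close> were nonzero, the line would meet \<open>x = 0\<close> away from the vertex,
  hence off the curve; if then \<open>b 3\<close> were zero, it would contain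
  \<open>E 0 0 1\<close>, again off the curve. So it is \<open>y = c * x\<close>, and its point with
  \<open>u = 0\<close>, \<open>x = 1\<close> forces the slope into \<open>C\<close>.\<close>

lemma line_in_hermitian_curve:
  assumes "l \<in> proj_lines" "l \<subseteq> hermitian_curve q H"
  shows "\<exists>c\<in>C. l = pencil_line (to_ac c)"
proof -
  obtain a where a: "a \<noteq> 0" and l: "l = {proj_point v | v. v \<noteq> 0 \<and> (\<Sum>i\<in>UNIV. a $ i * v $ i) = 0}"
    using assms(1) unfolding proj_lines_def by blast
  define b where "b i = (\<Sum>j\<in>UNIV. a $ j * ac_mat M $ j $ i)" for i
  have dot: "(\<Sum>i\<in>UNIV. a $ i * E u x y $ i) = u * b 1 + x * b 2 + y * b 3" for u x y
    by (simp add: b_def E_def matrix_vector_mult_def sum_3 algebra_simps)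
  have on_l: "proj_point (E u x y) \<in> hermitian_curve q H"
    if "E u x y \<noteq> 0" "u * b 1 + x * b 2 + y * b 3 = 0" for u x y
    using assms(2) that unfolding l dot[symmetric] by blast
  have "b 1 = 0"
  proof (rule ccontr)
    assume "b 1 \<noteq> 0"
    hence "proj_point (E (- b 3 / b 1) 0 1) \<in> hermitian_curve q H"
      by (intro on_l) (simp_all add: E_eq_0_iff)
    thus False
      by (simp add: E_mem_hermitian_curve_iff E_eq_0_iff)
  qed
  have "b 3 \<noteq> 0"
  proof
    assume "b 3 = 0"
    hence "proj_point (E 0 0 1) \<in> hermitian_curve q H"
      using \<open>b 1 = 0\<close> by (intro on_l) (simp_all add: E_eq_0_iff)
    thus False
      by (simp add: E_mem_hermitian_curve_iff E_eq_0_iff)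
  qed
  hence "proj_point (E 0 1 (- b 2 / b 3)) \<in> hermitian_curve q H"
    by (intro on_l) (simp_all add: E_eq_0_iff)
  then obtain c where c: "c \<in> C" "- b 2 / b 3 = to_ac c"
    by (auto simp: E_mem_hermitian_curve_iff E_eq_0_iff)
  have "(\<Sum>i\<in>UNIV. a $ i * v $ i) = 0 \<longleftrightarrow> coord 3 v = to_ac c * coord 2 v" for v
  proof -
    obtain u x y where v: "v = E u x y"
      using ex_E by blast
    have "- b 2 = to_ac c * b 3"
      using c(2) \<open>b 3 \<noteq> 0\<close> by (simp add: field_simps)
    hence "b 2 = - (to_ac c * b 3)"
      by (metis minus_minus)
    hence "x * b 2 + y * b 3 = b 3 * (y - to_ac c * x)"
      by (simp add: algebra_simps)
    thus ?thesis
      unfolding v dot \<open>b 1 = 0\<close> using \<open>b 3 \<noteq> 0\<close> by simp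
  qed
  hence "l = pencil_line (to_ac c)"
    unfolding l pencil_line_def by simp
  with c(1) show ?thesis
    by blast
qed

section \<open>Restriction of the form to the pencil\<close>

lemma f_on_plane:
  "\<exists>G. total_degree_le d G \<and> (\<forall>s c. poly (poly G [:s:]) c = f s 1 c)"
proof -
  obtain G where G: "total_degree_le d G"
    "\<And>s c. poly (poly G [:s:]) c = eval_ac F (s *s E 1 0 0 + E 0 1 0 + c *s E 0 0 1)"
    using eval_ac_on_plane[OF hom] by blast
  have "poly (poly G [:s:]) c = f s 1 c" for s c
    by (simp add: G(2) f_def E_scale E_add)
  with G(1) show ?thesis
    by blast
qed

lemma f_on_line: "\<exists>R. \<forall>r. poly R r = f (u + r * u') (x + r * x') (y + r * y')"
  using eval_ac_on_line[of F "E u x y" "E u' x' y'"] by (simp add: f_def E_scale E_add)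

text \<open>Reaches points with \<open>x = 0\<close>, invisible in the chart \<open>x = 1\<close>,
  along a line whose other points, up to finitely many, are already known zeros.\<close>

lemma f_eq_0_at_limit:
  assumes "finite A" "\<And>r. r \<notin> A \<Longrightarrow> f (u + r * u') (x + r * x') (y + r * y') = 0"
  shows "f u x y = 0"
proof -
  obtain R where R: "\<And>r. poly R r = f (u + r * u') (x + r * x') (y + r * y')"
    using f_on_line[of u u' x x' y y'] by blast
  have "R = 0"
    by (rule poly_eq_0_if_cofinite_roots[OF assms(1)]) (simp add: R assms(2))
  thus ?thesis
    using R[of 0] by simp
qed

lemma f_dehomogenize:
  assumes "x \<noteq> 0"
  shows "f u x y = x ^ d * f (u / x) 1 (y / x)"
  using f_scale[of x "u / x" 1 "y / x"] assms by simp

lemma f_not_identically_0: "\<exists>s c. f s 1 c \<noteq> 0"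
proof (rule ccontr)
  assume "\<nexists>s c. f s 1 c \<noteq> 0"
  hence nz: "f u x y = 0" if "x \<noteq> 0" for u x y
    using f_dehomogenize[OF that, of u y] by simp
  have "f u x y = 0" for u x y
    \<comment> \<open>Moving in the \<open>x\<close> direction, only the parameter
      \<open>- x\<close> leaves the chart.\<close>
    by (rule f_eq_0_at_limit[of "{- x}" _ 0 _ 1 _ 0]) (auto intro!: nz simp: add_eq_0_iff)
  hence "eval_ac F v = 0" for v
    using ex_E[of v] by (auto simp: f_def)
  hence "F = 0"
    by (rule eval_ac_eq_0_imp_eq_0[OF hom])
  with F_nz show False ..
qed

text \<open>Slopes of the lines of the curve lying in the zero set, tested in the chart only;
  \<open>T_eq\<close> shows that the vertex then follows.\<close>

definition T :: "'k set" where
  "T = {c \<in> C. \<forall>s. f s 1 (to_ac c) = 0}"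

text \<open>All three claims rest on one polynomial \<open>G\<close> for \<open>f s 1 c\<close> and
  on \<open>card T + degree G \<le> d\<close>. A slope of \<open>C\<close> outside \<open>T\<close>
  leaves a nonzero polynomial in \<open>s\<close> of degree at most \<open>degree G\<close>; if
  \<open>card T = d\<close>, then \<open>G\<close> is constant in \<open>s\<close>.\<close>

lemma card_T_le: "card T \<le> d"
  and card_zeros_le: "c \<notin> T \<Longrightarrow> c \<in> C \<Longrightarrow> card {s. f (to_ac s) 1 (to_ac c) = 0} \<le> d - card T"
  and ex_poly_if_card_T_eq: "card T = d \<Longrightarrow>
    \<exists>g. g \<noteq> 0 \<and> degree g = d \<and> (\<forall>s c. f s 1 c = poly g c) \<and> {c. poly g c = 0} = to_ac ` T"
proof -
  obtain G where G: "total_degree_le d G" "\<And>s c. poly (poly G [:s:]) c = f s 1 c"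
    using f_on_plane by blast
  have "G \<noteq> 0"
    using f_not_identically_0 G(2) by (metis poly_0)
  have card_image: "card (to_ac ` T) = card T"
    by (simp add: card_image inj_on_def)
  have le: "card T + degree G \<le> d"
    unfolding card_image[symmetric]
    by (rule total_degree_le_roots[OF G(1) \<open>G \<noteq> 0\<close>]) (auto simp: G(2) T_def)
  thus "card T \<le> d"
    by simp
  show "card {s. f (to_ac s) 1 (to_ac c) = 0} \<le> d - card T" if "c \<notin> T" "c \<in> C"
  proof -
    define R where "R = map_poly (\<lambda>g. poly g (to_ac c)) G"
    have R: "poly R s = f s 1 (to_ac c)" for s
      unfolding R_def by (simp add: G(2) flip: poly_poly_const_eq_poly_map_poly)
    have "R \<noteq> 0"
      using that R unfolding T_def by auto
    have "card {s. f (to_ac s) 1 (to_ac c) = 0} = card (to_ac ` {s. f (to_ac s) 1 (to_ac c) = 0})"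
      by (simp add: Finite_Set.card_image inj_on_def)
    also have "\<dots> \<le> card {s. poly R s = 0}"
      by (intro card_mono poly_roots_finite[OF \<open>R \<noteq> 0\<close>]) (auto simp: R)
    also have "\<dots> \<le> degree R"
      by (rule card_poly_roots_bound[OF \<open>R \<noteq> 0\<close>])
    also have "\<dots> \<le> degree G"
      unfolding R_def by (rule degree_le) (simp add: coeff_map_poly coeff_eq_0)
    finally show ?thesis
      using le by simp
  qed
  show "\<exists>g. g \<noteq> 0 \<and> degree g = d \<and> (\<forall>s c. f s 1 c = poly g c) \<and> {c. poly g c = 0} = to_ac ` T"
    if "card T = d"
  proof -
    have "degree G = 0"
      using le that by simp
    then obtain g where g: "G = [:g:]"
      by (rule degree_eq_zeroE)
    have "g \<noteq> 0"
      using \<open>G \<noteq> 0\<close> g by simp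
    have eq: "f s 1 c = poly g c" for s c
      by (simp add: g flip: G(2))
    have "degree g \<le> d"
      using G(1) \<open>g \<noteq> 0\<close> unfolding total_degree_le_def g by (auto dest: spec[of _ 0])
    have sub: "to_ac ` T \<subseteq> {c. poly g c = 0}"
      by (auto simp: T_def eq)
    have roots_le: "card {c. poly g c = 0} \<le> degree g"
      by (rule card_poly_roots_bound[OF \<open>g \<noteq> 0\<close>])
    have fin: "finite {c. poly g c = 0}"
      by (rule poly_roots_finite[OF \<open>g \<noteq> 0\<close>])
    \<comment> \<open>Squeeze: \<open>d\<close> known roots, at most \<open>degree g\<close> roots,
      and \<open>degree g \<le> d\<close> force equality throughout.\<close>
    have "d \<le> card {c. poly g c = 0}"
      using card_mono[OF fin sub] card_image that by simp
    hence "degree g = d"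
      using roots_le \<open>degree g \<le> d\<close> by simp
    moreover have "{c. poly g c = 0} = to_ac ` T"
      using card_seteq[OF fin sub] roots_le \<open>degree g \<le> d\<close> card_image that by simp
    ultimately show ?thesis
      using \<open>g \<noteq> 0\<close> eq by blast
  qed
qed

text \<open>The point \<open>(u, 0, 0)\<close> is the limit at \<open>r = 0\<close> of
  \<open>(u, r, r * c)\<close>, which for nonzero \<open>r\<close> rescales to a chart point of
  slope \<open>c\<close>.\<close>

lemma vertex_zero_if_line_zero:
  assumes "\<And>s. f s 1 c = 0"
  shows "f u 0 0 = 0"
proof (rule f_eq_0_at_limit[of "{0}" _ 0 _ 1 _ c])
  fix r :: "'k alg_closure" assume "r \<notin> {0}"
  thus "f (u + r * 0) (0 + r * 1) (0 + r * c) = 0"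
    using assms by (subst f_dehomogenize) auto
qed simp

lemma pencil_line_subset_zero_set_iff:
  "pencil_line c \<subseteq> zero_set F \<longleftrightarrow> (\<forall>s. f s 1 c = 0)"
proof
  assume "pencil_line c \<subseteq> zero_set F"
  hence "E s 1 (c * 1) \<noteq> 0 \<longrightarrow> proj_point (E s 1 (c * 1)) \<in> zero_set F" for s
    unfolding pencil_line_subset_iff by blast
  thus "\<forall>s. f s 1 c = 0"
    by (simp add: E_mem_zero_set_iff E_eq_0_iff)
next
  assume zero: "\<forall>s. f s 1 c = 0"
  have "f u x (c * x) = 0" for u x
  proof (cases "x = 0")
    case True
    thus ?thesis
      using vertex_zero_if_line_zero[of c u] zero by simp
  next
    case False
    thus ?thesis
      using zero by (subst f_dehomogenize) auto
  qed
  thus "pencil_line c \<subseteq> zero_set F"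
    unfolding pencil_line_subset_iff by (simp add: E_mem_zero_set_iff)
qed

lemma T_eq: "T = {c \<in> C. pencil_line (to_ac c) \<subseteq> zero_set F}"
  by (simp add: T_def pencil_line_subset_zero_set_iff)

text \<open>The dehomogenised equation \<open>g\<close> does not see the line at infinity \<open>x = 0\<close>; there the value of
  \<open>F\<close> is the leading coefficient of \<open>g\<close>, which is nonzero because \<open>g\<close> has full degree \<open>d\<close>.\<close>

lemma zero_set_eq_if_card_T_eq:
  assumes "card T = d"
  shows "zero_set F = \<Union> ((\<lambda>c. pencil_line (to_ac c)) ` T)"
proof
  show "\<Union> ((\<lambda>c. pencil_line (to_ac c)) ` T) \<subseteq> zero_set F"
    by (auto simp: T_eq)
  obtain g where g: "g \<noteq> 0" "degree g = d" "\<And>s c. f s 1 c = poly g c" "{c. poly g c = 0} = to_ac ` T"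
    using ex_poly_if_card_T_eq[OF assms] by blast
  show "zero_set F \<subseteq> \<Union> ((\<lambda>c. pencil_line (to_ac c)) ` T)"
  proof
    fix p assume p: "p \<in> zero_set F"
    then obtain v where v: "p = proj_point v" "v \<noteq> 0"
      unfolding zero_set_def by blast
    obtain u x y where E: "v = E u x y"
      using ex_E by blast
    have zero: "f u x y = 0"
      using p v unfolding E by (simp add: E_mem_zero_set_iff)
    have "\<exists>c\<in>T. y = to_ac c * x"
    proof (cases "x = 0")
      case False
      hence "y / x \<in> to_ac ` T"
        using zero f_dehomogenize[of x u y] by (simp add: g(3) flip: g(4))
      thus ?thesis
        using False by (auto simp: field_simps)
    next
      case True
      have "y = 0"
      proof (rule ccontr)
        assume "y \<noteq> 0"
        \<comment> \<open>Approaches \<open>(u / y, 0, 1)\<close> through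
          \<open>(u / y, r, 1)\<close>: for nonzero \<open>r\<close> the value is
          \<open>r ^ d * poly g (1 / r)\<close>, the reflected polynomial of \<open>g\<close> at
          \<open>r\<close>, whose value at 0 is the leading coefficient of \<open>g\<close>.\<close>
        obtain R where R: "\<And>r. poly R r = f (u / y + r * 0) (0 + r * 1) (1 + r * 0)"
          using f_on_line[of "u / y" 0 0 1 1 0] by blast
        have "R - reflect_poly g = 0"
        proof (rule poly_eq_0_if_cofinite_roots[of "{0}"])
          fix r :: "'k alg_closure" assume "r \<notin> {0}"
          thus "poly (R - reflect_poly g) r = 0"
            using f_dehomogenize[of r "u / y" 1]
            by (simp add: R g(2,3) poly_reflect_poly_nz divide_inverse)
        qed simp
        hence "poly R 0 = poly (reflect_poly g) 0"
          by simp
        hence "f (u / y) 0 1 \<noteq> 0"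
          using g(1) by (simp add: R)
        moreover have "f u x y = y ^ d * f (u / y) 0 1"
          using f_scale[of y "u / y" 0 1] True \<open>y \<noteq> 0\<close> by simp
        ultimately show False
          using zero \<open>y \<noteq> 0\<close> by simp
      qed
      \<comment> \<open>What remains is the vertex, which lies on every line of the pencil;
        \<open>1 \<le> d\<close> provides one with slope in \<open>T\<close>.\<close>
      moreover have "T \<noteq> {}"
        using assms d_pos by auto
      ultimately show ?thesis
        using True by auto
    qed
    thus "p \<in> \<Union> ((\<lambda>c. pencil_line (to_ac c)) ` T)"
      using v unfolding E by (auto simp: E_mem_pencil_line_iff)
  qed
qed

section \<open>Counting the rational points\<close>

lemma rational_points_eq:
  "rational_points (hermitian_curve q H \<inter> zero_set F) =
    (if f 1 0 0 = 0 then {proj_point (E 1 0 0)} else {}) \<union>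
    (\<lambda>(c, s). proj_point (E (to_ac s) 1 (to_ac c))) `
      (SIGMA c:C. {s. f (to_ac s) 1 (to_ac c) = 0})" (is "?L = ?V \<union> ?R")
proof
  have rational: "\<exists>w. proj_point (E (to_ac u) (to_ac x) (to_ac y)) = proj_point (\<chi> i. to_ac (w $ i)) \<and> w \<noteq> 0"
    if "E (to_ac u) (to_ac x) (to_ac y) \<noteq> 0" for u x y
  proof -
    have "vector [to_ac u, to_ac x, to_ac y] = (ac_vec (vector [u, x, y]) :: 'k alg_closure ^ 3)"
      by (simp add: ac_vec_def vec_eq_iff forall_3)
    hence eq: "E (to_ac u) (to_ac x) (to_ac y) = ac_vec (M *v vector [u, x, y])"
      by (simp add: E_def ac_mat_mult_ac_vec)
    show ?thesis
      using that unfolding eq by (intro exI[of _ "M *v vector [u, x, y]"]) (simp add: ac_vec_def[symmetric])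
  qed
  show "?V \<union> ?R \<subseteq> ?L"
  proof
    fix p assume "p \<in> ?V \<union> ?R"
    then consider "p = proj_point (E (to_ac 1) (to_ac 0) (to_ac 0))" "f 1 0 0 = 0"
      | s c where "p = proj_point (E (to_ac s) (to_ac 1) (to_ac c))" "c \<in> C" "f (to_ac s) 1 (to_ac c) = 0"
      by (auto split: if_splits)
    thus "p \<in> ?L"
    proof cases
      case 1
      thus ?thesis
        using rational[of 1 0 0] unfolding rational_points_def
        by (auto simp: E_mem_hermitian_curve_iff E_mem_zero_set_iff E_eq_0_iff)
    next
      case 2
      thus ?thesis
        using rational[of s 1 c] unfolding rational_points_def
        by (auto simp: E_mem_hermitian_curve_iff E_mem_zero_set_iff E_eq_0_iff)
    qed
  qed
  show "?L \<subseteq> ?V \<union> ?R"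
  proof
    fix p assume p: "p \<in> ?L"
    then obtain w :: "'k ^ 3" where w: "w \<noteq> 0" "p = proj_point (ac_vec w)"
      unfolding rational_points_def ac_vec_def by blast
    define u x y where "u = (N *v w) $ 1" and "x = (N *v w) $ 2" and "y = (N *v w) $ 3"
    have E: "ac_vec w = E (to_ac u) (to_ac x) (to_ac y)"
      using E_coord[of "ac_vec w"]
      by (simp add: coord_def u_def x_def y_def ac_mat_mult_ac_vec) (simp add: ac_vec_def)
    have nz: "E (to_ac u) (to_ac x) (to_ac y) \<noteq> 0"
      using w by (simp flip: E)
    have zero: "f (to_ac u) (to_ac x) (to_ac y) = 0"
      using p nz unfolding w E rational_points_def by (simp add: E_mem_zero_set_iff)
    have "x = 0 \<and> y = 0 \<or> (\<exists>c\<in>C. x \<noteq> 0 \<and> to_ac y = to_ac c * to_ac x)"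
      using p nz unfolding w E rational_points_def by (simp add: E_mem_hermitian_curve_iff)
    then consider "x = 0" "y = 0" | c where "c \<in> C" "x \<noteq> 0" "y = c * x"
      by (auto simp flip: to_ac_mult)
    thus "p \<in> ?V \<union> ?R"
    proof cases
      case 1
      hence "u \<noteq> 0"
        using nz by (auto simp: E_0)
      have "E (to_ac u) 0 0 = to_ac u *s E 1 0 0"
        by (simp add: E_scale)
      hence "p = proj_point (E 1 0 0)"
        unfolding w E 1 using \<open>u \<noteq> 0\<close>
        by (intro sym[OF iffD2[OF proj_point_eq_iff]]) (auto simp: E_eq_0_iff)
      moreover have "f 1 0 0 = 0"
        using zero f_scale[of "to_ac u" 1 0 0] \<open>u \<noteq> 0\<close> unfolding 1 by simp
      ultimately show ?thesis
        by simp
    next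
      case 2
      \<comment> \<open>Normalising to \<open>x = 1\<close> keeps the parameters in the ground
        field.\<close>
      have "E (to_ac u) (to_ac x) (to_ac y) = to_ac x *s E (to_ac (u / x)) 1 (to_ac c)"
        using 2 by (simp add: E_scale mult.commute)
      hence "p = proj_point (E (to_ac (u / x)) 1 (to_ac c))"
        unfolding w E using 2(2)
        by (intro sym[OF iffD2[OF proj_point_eq_iff]]) (auto simp: E_eq_0_iff simp del: to_ac_divide)
      moreover have "f (to_ac (u / x)) 1 (to_ac c) = 0"
        using zero f_dehomogenize[of "to_ac x" "to_ac u" "to_ac y"] 2 by simp
      ultimately show ?thesis
        using 2(1) by (intro UnI2 image_eqI[of _ _ "(c, u / x)"]) simp_all
    qed
  qed
qed

text \<open>The normalisation \<open>x = 1\<close> makes the pair \<open>(c, s)\<close> determined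
  by the point and separates these points from the vertex, so the union is disjoint and the count is
  a sum over lines.\<close>

lemma card_rational_points:
  "card (rational_points (hermitian_curve q H \<inter> zero_set F)) =
    (if f 1 0 0 = 0 then 1 else 0) + (\<Sum>c\<in>C. card {s. f (to_ac s) 1 (to_ac c) = 0})"
proof -
  let ?h = "\<lambda>(c, s). proj_point (E (to_ac s) 1 (to_ac c))"
  have "c = c' \<and> s = s'"
    if "proj_point (E (to_ac s) 1 (to_ac c)) = proj_point (E (to_ac s') 1 (to_ac c'))" for s s' c c'
    using that by (auto simp: proj_point_eq_iff E_eq_0_iff E_scale E_eq_iff)
  hence "inj ?h"
    by (auto intro!: injI)
  hence card_image: "card (?h ` S) = card S" for S
    by (meson card_image inj_on_subset subset_UNIV)
  have "proj_point (E 1 0 0) \<noteq> proj_point (E (to_ac s) 1 (to_ac c))" for s c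
    by (auto simp: proj_point_eq_iff E_eq_0_iff E_scale E_eq_iff)
  thus ?thesis
    unfolding rational_points_eq
    by (subst card_Un_disjoint) (auto simp: card_image card_SigmaI)
qed

lemma card_rational_points_cases:
  defines "n \<equiv> card (rational_points (hermitian_curve q H \<inter> zero_set F))"
  shows "card T < d \<Longrightarrow> n < d * q ^ 2 + 1" and "card T = d \<Longrightarrow> n = d * q ^ 2 + 1"
proof -
  let ?n = "\<lambda>c. card {s. f (to_ac s) 1 (to_ac c) = 0}"
  define t where "t = card T"
  have t_le: "t \<le> d"
    unfolding t_def by (rule card_T_le)
  have sub: "T \<subseteq> C"
    by (auto simp: T_def)
  have "(\<Sum>c\<in>C. ?n c) = (\<Sum>c\<in>C - T. ?n c) + (\<Sum>c\<in>T. ?n c)"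
    by (rule sum.subset_diff[OF sub]) simp
  also have "(\<Sum>c\<in>T. ?n c) = t * q ^ 2"
    by (simp add: T_def t_def card_k)
  finally have n: "n = (if f 1 0 0 = 0 then 1 else 0) + ((\<Sum>c\<in>C - T. ?n c) + t * q ^ 2)"
    unfolding n_def card_rational_points by simp
  have "(\<Sum>c\<in>C - T. ?n c) \<le> card (C - T) * (d - t)"
    using sum_bounded_above[of "C - T" ?n "d - t"] card_zeros_le by (simp add: t_def)
  also have "\<dots> \<le> (q + 1) * (d - t)"
    using card_mono[of C "C - T"] by (intro mult_right_mono) (auto simp: card_C)
  finally have off: "(\<Sum>c\<in>C - T. ?n c) \<le> (q + 1) * (d - t)" .
  show "n < d * q ^ 2 + 1" if "card T < d"
  proof -
    have "q * 2 \<le> q * q"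
      using q_ge_2 by (intro mult_left_mono) auto
    \<comment> \<open>Source of the strict inequality: a line outside \<open>T\<close> allows
      \<open>d - t\<close> points, and there are fewer than \<open>q ^ 2\<close> such lines.\<close>
    hence "q + 1 < q ^ 2"
      using q_ge_2 unfolding power2_eq_square by linarith
    hence "(q + 1) * (d - t) < q ^ 2 * (d - t)"
      using that unfolding t_def by (intro mult_strict_right_mono) simp_all
    moreover have "q ^ 2 * (d - t) + t * q ^ 2 = d * q ^ 2"
      using t_le by (simp add: algebra_simps flip: distrib_left)
    ultimately show ?thesis
      using off n by (auto split: if_splits)
  qed
  show "n = d * q ^ 2 + 1" if "card T = d"
  proof -
    have "T \<noteq> {}"
      using that d_pos by auto
    then obtain c where "c \<in> T"
      by blast
    \<comment> \<open>The summand 1 of the bound is the vertex, a zero because some line through it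
      lies in the zero set.\<close>
    hence "f 1 0 0 = 0"
      by (intro vertex_zero_if_line_zero[of "to_ac c"]) (simp add: T_def)
    thus ?thesis
      using n off that by (simp add: t_def)
  qed
qed

text \<open>Lines on the curve belong to the pencil, so any admissible \<open>L\<close> injects into
  \<open>T\<close> and \<open>d \<le> card T\<close>; conversely, the lines with slopes in
  \<open>T\<close> form such an \<open>L\<close>.\<close>

lemma union_of_lines_iff_card_T_eq:
  "(\<exists>L \<subseteq> proj_lines. card L = d \<and> (\<forall>l\<in>L. l \<subseteq> hermitian_curve q H) \<and> zero_set F = \<Union>L)
    \<longleftrightarrow> card T = d"
proof
  assume T: "card T = d"
  let ?L = "(\<lambda>c. pencil_line (to_ac c)) ` T"
  have "card ?L = d"
    using T by (subst card_image) (simp_all add: inj_on_def inj_eq[OF inj_pencil_line])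
  moreover have "\<forall>l\<in>?L. l \<subseteq> hermitian_curve q H"
    using pencil_line_subset_hermitian_curve by (auto simp: T_def)
  moreover have "?L \<subseteq> proj_lines"
    using pencil_line_in_proj_lines by auto
  ultimately show "\<exists>L \<subseteq> proj_lines. card L = d \<and> (\<forall>l\<in>L. l \<subseteq> hermitian_curve q H) \<and> zero_set F = \<Union>L"
    using zero_set_eq_if_card_T_eq[OF T] by (intro exI[of _ ?L] conjI)
next
  assume "\<exists>L \<subseteq> proj_lines. card L = d \<and> (\<forall>l\<in>L. l \<subseteq> hermitian_curve q H) \<and> zero_set F = \<Union>L"
  then obtain L where L: "L \<subseteq> proj_lines" "card L = d" "\<And>l. l \<in> L \<Longrightarrow> l \<subseteq> hermitian_curve q H"
    "zero_set F = \<Union>L"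
    by blast
  have "L \<subseteq> (\<lambda>c. pencil_line (to_ac c)) ` T"
  proof
    fix l assume l: "l \<in> L"
    then obtain c where "c \<in> C" "l = pencil_line (to_ac c)"
      using line_in_hermitian_curve[of l] L by blast
    thus "l \<in> (\<lambda>c. pencil_line (to_ac c)) ` T"
      using l L(4) by (auto simp: T_eq)
  qed
  hence "card L \<le> card T"
    by (rule surj_card_le[rotated]) simp
  thus "card T = d"
    using L(2) card_T_le by simp
qed

end

theorem theorem3p4:
  fixes q d :: nat
    and H :: "'k::{finite,field} ^ 3 ^ 3"
    and F :: "'k poly3"
  assumes "primepow q" and "CARD('k) = q ^ 2"
    and "1 \<le> d" and "d \<le> q"
    and "hermitian_matrix q H" and "rank H = 2"
    and "F \<noteq> 0" and "homogeneous d F"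
  shows "card (rational_points (hermitian_curve q H \<inter> zero_set F)) \<le> d * q ^ 2 + 1
    \<and> (card (rational_points (hermitian_curve q H \<inter> zero_set F)) = d * q ^ 2 + 1 \<longleftrightarrow>
         (\<exists>L \<subseteq> proj_lines. card L = d \<and> (\<forall>l\<in>L. l \<subseteq> hermitian_curve q H) \<and>
            zero_set F = \<Union>L))"
proof -
  obtain M N :: "'k ^ 3 ^ 3" and \<alpha> \<beta> where "M ** N = mat 1" "N ** M = mat 1"
    "\<alpha> \<noteq> 0" "\<beta> \<noteq> 0" "\<alpha> ^ q = \<alpha>" "\<beta> ^ q = \<beta>"
    "\<And>v. sesq q (ac_mat H) (ac_mat M *v v) (ac_mat M *v v) =
       to_ac \<alpha> * v $ 2 ^ (q + 1) + to_ac \<beta> * v $ 3 ^ (q + 1)"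
    using hermitian_normal_form[OF assms(1,2,5,6)] by blast
  then interpret hermitian_pencil q d H F M N \<alpha> \<beta>
    using assms by unfold_locales simp_all
  \<comment> \<open>The bound is strict in the first case and attained in the second, so attaining
    it is equivalent to \<open>card T = d\<close>.\<close>
  have "card T < d \<or> card T = d"
    using card_T_le by linarith
  thus ?thesis
    using card_rational_points_cases unfolding union_of_lines_iff_card_T_eq by fastforce
qed

end
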